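(* Let $0\le\alpha\le 1$ and let $\mu$ be the Lebesgue measure on the torus $\mathbb{T}^d=\mathbb{R}^d/\mathbb{Z}^d$. For a measurable set $\Omega\subseteq\mathbb{T}^d$ let $$M(\alpha,\Omega)=\sup_{t>0}t^{-\alpha}\mu\left(\{x\in\mathbb{T}^d:\operatorname{dist}(x,\partial\Omega)<t\}\right).$$ If $m^{1/d}$ is a positive integer, let $L(m)=m^{-1/d}\mathbb{Z}^d$ (modulo $\mathbb{Z}^d$) be the set of the $m$ lattice points $m^{-1/d}(g_1,\dots,g_d)$ with $g_j\in\{0,1,\dots,m^{1/d}-1\}$. Then there exists a constant $c$ such that for every $m\ge 1$ with $m^{1/d}$ an integer and every $\gamma>0$, $$\sup_{M(\alpha,\Omega)<\gamma}\left|\mu(\Omega)-m^{-1}\sum_{x\in L(m)}\chi_\Omega(x)\right|\le c\,\gamma\, m^{-\alpha/d},$$ where the supremum is over all measurable sets $\Omega\subseteq\mathbb{T}^d$ with $M(\alpha,\Omega)<\gamma$.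
   Context: $\chi_\Omega$ is the characteristic function of $\Omega$, $\partial\Omega$ its topological boundary in the torus, and $\operatorname{dist}$ is the distance on $\mathbb{T}^d$ induced by the Euclidean distance on $\mathbb{R}^d$ (with $\operatorname{dist}(x,\emptyset)=+\infty$). The constant $c$ may depend on $d$ and $\alpha$ but not on $m$, $\gamma$, $\Omega$. *)

theory Defs
  imports "HOL-Analysis.Analysis"
begin

section \<open>The torus as a metric space\<close>

definition int_translate :: "real ^ 'n \<Rightarrow> real ^ 'n \<Rightarrow> bool" where
  "int_translate x y \<longleftrightarrow> (\<forall>i. x $ i - y $ i \<in> \<int>)"

lemma equivp_int_translate: "equivp int_translate"
proof (rule equivpI)
  show "reflp int_translate"
    by (simp add: reflp_def int_translate_def)
  show "symp int_translate"
    unfolding symp_def int_translate_def by (metis Ints_minus minus_diff_eq)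
  show "transp int_translate"
    unfolding transp_def int_translate_def
    by (metis Ints_add add_diff_eq diff_add_cancel)
qed

quotient_type 'n torus = "real ^ ('n::finite)" / int_translate
  by (rule equivp_int_translate)

abbreviation torus_proj :: "real ^ 'n \<Rightarrow> 'n::finite torus" where
  "torus_proj \<equiv> abs_torus"

lemma torus_proj_eq_iff: "torus_proj x = torus_proj y \<longleftrightarrow> int_translate x y"
  by (rule torus.abs_eq_iff)

lemma torus_proj_exhaust: obtains x where "p = torus_proj x"
  by (metis Quotient3_abs_rep Quotient3_torus)

abbreviation torus_fiber :: "'n::finite torus \<Rightarrow> (real ^ 'n) set" where
  "torus_fiber p \<equiv> torus_proj -` {p}"

lemma torus_fiber_nonempty: "torus_fiber p \<noteq> {}"
  by (metis torus_proj_exhaust insert_not_empty vimage_singleton_eq empty_iff)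

lemma torus_fiber_translate:
  assumes "b \<in> torus_fiber q" "b' \<in> torus_fiber q" "c \<in> torus_fiber r"
  shows "c + (b - b') \<in> torus_fiber r"
proof -
  have "int_translate b b'"
    using assms by (simp flip: torus_proj_eq_iff)
  then have "int_translate (c + (b - b')) c"
    by (simp add: int_translate_def)
  then show ?thesis
    using assms by (simp flip: torus_proj_eq_iff)
qed

lemma closed_torus_fiber: "closed (torus_fiber p)"
proof -
  obtain x where p: "p = torus_proj x"
    by (rule torus_proj_exhaust)
  have "torus_fiber p = (\<Inter>i. (\<lambda>y. y $ i - x $ i) -` \<int>)"
    by (auto simp: p torus_proj_eq_iff int_translate_def)
  moreover have "closed (\<int> :: real set)"
    using closed_of_int_image[of UNIV] by (simp add: Ints_def)
  ultimately show ?thesis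
    by (auto intro!: closed_INT continuous_closed_vimage continuous_intros)
qed

instantiation torus :: (finite) metric_space
begin

text \<open>The distance of two points of the torus is the infimum of the Euclidean distances
  of their representatives.\<close>

definition dist_torus :: "'a torus \<Rightarrow> 'a torus \<Rightarrow> real" where
  "dist_torus p q = setdist (torus_fiber p) (torus_fiber q)"

definition uniformity_torus :: "('a torus \<times> 'a torus) filter" where
  "uniformity_torus = (INF e\<in>{0<..}. principal {(x, y). dist x y < e})"

definition open_torus :: "'a torus set \<Rightarrow> bool" where
  "open_torus U \<longleftrightarrow> (\<forall>x\<in>U. eventually (\<lambda>(x', y). x' = x \<longrightarrow> y \<in> U) uniformity)"

instance
proof
  fix p q r :: "'a torus"
  have sing: "setdist {x} (torus_fiber q) \<le> setdist (torus_fiber p) (torus_fiber q)"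
    if x: "x \<in> torus_fiber p" for x and p q :: "'a torus"
  proof (rule le_setdistI)
    fix a b assume ab: "a \<in> torus_fiber p" "b \<in> torus_fiber q"
    have "b + (x - a) \<in> torus_fiber q"
      using torus_fiber_translate[OF x ab] .
    then have "setdist {x} (torus_fiber q) \<le> dist x (b + (x - a))"
      by (intro setdist_le_dist) auto
    also have "\<dots> = dist a b"
      by (simp add: dist_norm)
    finally show "setdist {x} (torus_fiber q) \<le> dist a b" .
  qed (use torus_fiber_nonempty in auto)
  show "dist p q = 0 \<longleftrightarrow> p = q"
  proof
    assume d: "dist p q = 0"
    obtain x where x: "x \<in> torus_fiber p"
      using torus_fiber_nonempty by blast
    have "setdist {x} (torus_fiber q) = 0"
      using sing[OF x, of q] d setdist_pos_le[of "{x}"] unfolding dist_torus_def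
      by (metis order_antisym)
    then have "x \<in> torus_fiber q"
      using torus_fiber_nonempty[of q] closed_torus_fiber[of q]
      by (simp add: setdist_eq_0_sing_1 closure_closed)
    then show "p = q"
      using x by simp
  next
    assume "p = q"
    then show "dist p q = 0"
      by (simp only: dist_torus_def setdist_refl)
  qed
  show "dist p q \<le> dist p r + dist q r"
  proof (rule field_le_epsilon)
    fix e :: real assume e: "0 < e"
    have "setdist (torus_fiber p) (torus_fiber r) < dist p r + e / 2"
      using e by (simp add: dist_torus_def)
    then obtain a b where ab: "a \<in> torus_fiber p" "b \<in> torus_fiber r" "dist a b < dist p r + e / 2"
      using torus_fiber_nonempty by (metis setdist_ltE)
    have "setdist (torus_fiber q) (torus_fiber r) < dist q r + e / 2"
      using e by (simp add: dist_torus_def)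
    then obtain c b' where cb: "c \<in> torus_fiber q" "b' \<in> torus_fiber r" "dist c b' < dist q r + e / 2"
      using torus_fiber_nonempty by (metis setdist_ltE)
    have "c + (b - b') \<in> torus_fiber q"
      using torus_fiber_translate ab cb by blast
    then have "dist p q \<le> dist a (c + (b - b'))"
      unfolding dist_torus_def using ab by (intro setdist_le_dist)
    also have "\<dots> \<le> dist a b + dist b (c + (b - b'))"
      by (rule dist_triangle)
    also have "dist b (c + (b - b')) = dist c b'"
      by (simp add: dist_norm norm_minus_commute)
    finally show "dist p q \<le> dist p r + dist q r + e"
      using ab cb by linarith
  qed
qed (rule uniformity_torus_def open_torus_def)+

end

lemma dist_torus_proj_le: "dist (torus_proj x) (torus_proj y) \<le> dist x y"
  unfolding dist_torus_def by (rule setdist_le_dist) auto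

lemma continuous_on_torus_proj: "continuous_on A torus_proj"
  unfolding continuous_on_iff by (metis dist_torus_proj_le le_less_trans)

text \<open>The metric induces the quotient topology.\<close>

lemma open_torus_iff: "open S \<longleftrightarrow> open (torus_proj -` S)"
proof
  assume "open S"
  then show "open (torus_proj -` S)"
    by (intro open_vimage continuous_on_torus_proj)
next
  assume o: "open (torus_proj -` S)"
  show "open S"
    unfolding open_dist
  proof
    fix p assume p: "p \<in> S"
    obtain x where x: "p = torus_proj x"
      by (rule torus_proj_exhaust)
    then have "x \<in> torus_proj -` S"
      using p by simp
    then have "\<exists>e>0. \<forall>y. dist y x < e \<longrightarrow> y \<in> torus_proj -` S"
      using o unfolding open_dist by (rule bspec[rotated])
    then obtain e where e: "e > 0" "\<And>y. dist y x < e \<Longrightarrow> torus_proj y \<in> S"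
      by auto
    have "q \<in> S" if "dist q p < e" for q
    proof -
      obtain a b where ab: "a \<in> torus_fiber q" "b \<in> torus_fiber p" "dist a b < e"
        using \<open>dist q p < e\<close> torus_fiber_nonempty unfolding dist_torus_def
        by (metis setdist_ltE)
      have "x \<in> torus_fiber p"
        by (simp add: x)
      from torus_fiber_translate[OF this ab(2,1)]
      have "torus_proj (a + (x - b)) = q"
        by simp
      moreover have "dist (a + (x - b)) x = dist a b"
        by (simp add: dist_norm)
      ultimately show "q \<in> S"
        using e(2) ab(3) by metis
    qed
    with e(1) show "\<exists>e>0. \<forall>y. dist y p < e \<longrightarrow> y \<in> S"
      by blast
  qed
qed


section \<open>Lebesgue measure on the torus\<close>

definition unit_cell :: "(real ^ 'n) set" where
  "unit_cell = {x. \<forall>i. 0 \<le> x $ i \<and> x $ i < 1}"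

text \<open>The \<open>\<sigma>\<close>-algebra consists of all sets whose preimage in Euclidean space is Lebesgue
  measurable; the measure is the image of Lebesgue measure on the fundamental cell.\<close>

definition torus_lebesgue :: "'n::finite torus measure" where
  "torus_lebesgue =
     distr (lebesgue_on unit_cell) (sigma UNIV {A. torus_proj -` A \<in> sets lebesgue}) torus_proj"

lemma space_torus_lebesgue [simp]: "space torus_lebesgue = UNIV"
  by (simp add: torus_lebesgue_def)

lemma sets_torus_lebesgue:
  "sets (torus_lebesgue :: 'n::finite torus measure) = {A. torus_proj -` A \<in> sets lebesgue}"
proof -
  have "sigma_algebra UNIV {A :: 'n torus set. torus_proj -` A \<in> sets lebesgue}"
  proof (rule sigma_algebra_iff2[THEN iffD2], intro conjI ballI allI impI)
    fix A :: "'n torus set" assume "A \<in> {A. torus_proj -` A \<in> sets lebesgue}"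
    then have "UNIV - torus_proj -` A \<in> sets lebesgue"
      using sets.compl_sets[of "torus_proj -` A" lebesgue] by simp
    then show "UNIV - A \<in> {A. torus_proj -` A \<in> sets lebesgue}"
      by (simp add: vimage_Diff)
  next
    fix A :: "nat \<Rightarrow> 'n torus set"
    assume "range A \<subseteq> {A. torus_proj -` A \<in> sets lebesgue}"
    then have "\<And>i. torus_proj -` A i \<in> sets lebesgue" by auto
    then show "(\<Union>i. A i) \<in> {A. torus_proj -` A \<in> sets lebesgue}"
      by (simp add: vimage_UN sets.countable_UN)
  qed auto
  then show ?thesis
    by (simp add: torus_lebesgue_def sigma_algebra.sigma_sets_eq)
qed

lemma unit_cell_sets: "unit_cell \<in> sets (lebesgue :: (real ^ 'n) measure)"
proof -
  have "unit_cell = (\<Inter>i. {x :: real ^ 'n. 0 \<le> x $ i} \<inter> {x. x $ i < 1})"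
    by (auto simp: unit_cell_def)
  also have "\<dots> \<in> sets borel"
    by (intro sets.countable_INT' sets.Int borel_closed borel_open closed_Collect_le
          open_Collect_less continuous_intros) auto
  finally show ?thesis by simp
qed

lemma emeasure_torus_lebesgue:
  fixes A :: "'n::finite torus set"
  assumes "A \<in> sets torus_lebesgue"
  shows "emeasure torus_lebesgue A = emeasure lebesgue (torus_proj -` A \<inter> unit_cell)"
proof -
  let ?N = "sigma UNIV {A :: 'n torus set. torus_proj -` A \<in> sets lebesgue}"
  have sN: "sets ?N = {A. torus_proj -` A \<in> sets lebesgue}"
    using sets_torus_lebesgue by (simp add: torus_lebesgue_def)
  have "torus_proj \<in> measurable (lebesgue_on unit_cell) ?N"
  proof (rule measurableI)
    fix B assume "B \<in> sets ?N"
    then show "torus_proj -` B \<inter> space (lebesgue_on unit_cell) \<in> sets (lebesgue_on unit_cell)"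
      unfolding sN using unit_cell_sets
      by (auto simp: space_restrict_space sets_restrict_space)
  qed simp
  moreover have "A \<in> sets ?N"
    using assms unfolding torus_lebesgue_def sets_distr .
  ultimately have "emeasure torus_lebesgue A =
      emeasure (lebesgue_on unit_cell) (torus_proj -` A \<inter> unit_cell)"
    unfolding torus_lebesgue_def by (subst emeasure_distr) (auto simp: space_restrict_space)
  also have "\<dots> = emeasure lebesgue (torus_proj -` A \<inter> unit_cell)"
    using unit_cell_sets by (intro emeasure_restrict_space) auto
  finally show ?thesis .
qed

lemma open_sets_torus_lebesgue: "open A \<Longrightarrow> A \<in> sets torus_lebesgue"
  by (simp add: sets_torus_lebesgue open_torus_iff borel_open)


section \<open>Boundary neighbourhoods\<close>

text \<open>Unlike \<^const>\<open>infdist\<close>, the distance to the empty set is infinite here.\<close>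

definition dist_to_set :: "'a::metric_space \<Rightarrow> 'a set \<Rightarrow> ereal" where
  "dist_to_set x A = (INF y\<in>A. ereal (dist x y))"

definition boundary_M :: "real \<Rightarrow> 'n::finite torus set \<Rightarrow> ennreal" where
  "boundary_M \<alpha> \<Omega> =
     (SUP t\<in>{0<..}. ennreal (t powr (-\<alpha>)) *
        emeasure torus_lebesgue {x. dist_to_set x (frontier \<Omega>) < ereal t})"

lemma sets_dist_to_set_less: "{x. dist_to_set x A < ereal t} \<in> sets torus_lebesgue"
proof (rule open_sets_torus_lebesgue)
  have "{x. dist_to_set x A < ereal t} = (\<Union>y\<in>A. ball y t)"
    by (auto simp: dist_to_set_def INF_less_iff dist_commute)
  then show "open {x. dist_to_set x A < ereal t}"
    by auto
qed


section \<open>Lattice points\<close>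

definition torus_lattice :: "nat \<Rightarrow> 'n::finite torus set" where
  "torus_lattice m =
     {torus_proj ((1 / root CARD('n) (real m)) *\<^sub>R (\<chi> j. real (g j))) | g.
        \<forall>j. real (g j) < root CARD('n) (real m)}"

lemma card_torus_lattice:
  assumes m: "m \<ge> 1" and int: "root CARD('n) (real m) \<in> \<int>"
  shows "card (torus_lattice m :: 'n::finite torus set) = m"
proof -
  define N where "N = nat \<lfloor>root CARD('n) (real m)\<rfloor>"
  have pos: "root CARD('n) (real m) > 0"
    using m by simp
  have N: "root CARD('n) (real m) = real N"
    using int pos by (auto simp: N_def elim!: Ints_cases)
  have "real N ^ CARD('n) = real m"
    unfolding N[symmetric] using real_root_pow_pos2[of "CARD('n)" "real m"] by simp
  then have Nm: "N ^ CARD('n) = m"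
    by (metis of_nat_eq_iff of_nat_power)
  have N0: "N > 0"
    using N pos by simp
  let ?f = "\<lambda>g :: 'n \<Rightarrow> nat. torus_proj ((1 / real N) *\<^sub>R (\<chi> j. real (g j)))"
  let ?G = "UNIV \<rightarrow>\<^sub>E {..<N} :: ('n \<Rightarrow> nat) set"
  have im: "torus_lattice m = ?f ` ?G"
    unfolding torus_lattice_def N by (auto simp: PiE_UNIV_domain)
  have "inj_on ?f ?G"
  proof (rule inj_onI, rule ext)
    fix g h :: "'n \<Rightarrow> nat" and j
    assume gh: "g \<in> ?G" "h \<in> ?G" "?f g = ?f h"
    have "real (g j) / real N - real (h j) / real N \<in> \<int>"
      using gh(3) by (simp add: torus_proj_eq_iff int_translate_def)
    then obtain k where k: "real (g j) / real N - real (h j) / real N = of_int k"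
      by (auto elim: Ints_cases)
    have b: "g j < N" "h j < N"
      using gh by (auto simp: PiE_UNIV_domain)
    then have "real (g j) / real N < 1" "real (h j) / real N < 1"
      by auto
    moreover have "real (g j) / real N \<ge> 0" "real (h j) / real N \<ge> 0"
      by auto
    ultimately have "-1 < (of_int k :: real)" "(of_int k :: real) < 1"
      using k by linarith+
    then have "k = 0"
      by linarith
    then show "g j = h j"
      using k N0 by (simp add: field_simps)
  qed
  then have "card (?f ` ?G) = card ?G"
    by (rule card_image)
  then show ?thesis
    by (simp add: im card_PiE Nm)
qed

end

theory Submission
  imports Defs
begin

text \<open>
  Cut the unit cell into the \<open>m\<close> half-open cubes of side \<open>m\<^sup>-\<^sup>1\<^sup>/\<^sup>d\<close> whose lower corners
  are the lattice points, and replace \<open>\<Omega>\<close> by the union of the cubes whose corner lies in \<open>\<Omega>\<close>;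
  that union has measure exactly \<open>m\<^sup>-\<^sup>1 \<Sum>\<^bsub>x \<in> L(m)\<^esub> \<chi>\<^sub>\<Omega>(x)\<close>.
  A cube meeting both \<open>\<Omega>\<close> and its complement is connected, so it meets \<open>\<partial>\<Omega>\<close> and lies within
  its own diameter of \<open>\<partial>\<Omega>\<close>. Hence the symmetric difference lies in the \<open>t\<close>-neighbourhood of
  \<open>\<partial>\<Omega>\<close> with \<open>t = (d + 1) m\<^sup>-\<^sup>1\<^sup>/\<^sup>d\<close>, whose measure is at most \<open>\<gamma> t\<^sup>\<alpha>\<close>.
\<close>

section \<open>Half-open boxes in Euclidean space\<close>

text \<open>Half-open, so that adjacent boxes tile exactly: no gaps and no shared faces.\<close>

definition half_open_box :: "real ^ 'n \<Rightarrow> real ^ 'n \<Rightarrow> (real ^ 'n) set" where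
  "half_open_box a b = {x. \<forall>i. a $ i \<le> x $ i \<and> x $ i < b $ i}"

lemma half_open_box_sets [measurable]: "half_open_box a b \<in> sets (borel :: (real ^ 'n) measure)"
proof -
  have "half_open_box a b = (\<Inter>i. {x. a $ i \<le> x $ i} \<inter> {x. x $ i < b $ i})"
    by (auto simp: half_open_box_def)
  also have "\<dots> \<in> sets borel"
    by (intro sets.countable_INT' sets.Int borel_closed borel_open closed_Collect_le
          open_Collect_less continuous_intros) auto
  finally show ?thesis .
qed

text \<open>The set is squeezed between \<open>box a b\<close> and \<open>cbox a b\<close>, which
  have the same volume. The fact \<open>prod\<close> turns the product over \<open>Basis\<close>
  into one over coordinates.\<close>

lemma emeasure_half_open_box:
  fixes a b :: "real ^ 'n"
  assumes "\<And>i. a $ i \<le> b $ i"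
  shows "emeasure lebesgue (half_open_box a b) = ennreal (\<Prod>i\<in>UNIV. b $ i - a $ i)"
proof -
  have prod: "(\<Prod>e\<in>Basis. (b - a) \<bullet> e) = (\<Prod>i\<in>UNIV. b $ i - a $ i)"
    by (simp add: Basis_vec_def UNION_singleton_eq_range prod.reindex axis_eq_axis inj_on_def
        inner_axis)
  have le: "a \<bullet> e \<le> b \<bullet> e" if "e \<in> Basis" for e
    using that assms by (auto simp: Basis_vec_def inner_axis)
  have "box a b \<subseteq> half_open_box a b" "half_open_box a b \<subseteq> cbox a b"
    by (auto simp: half_open_box_def mem_box_cart less_imp_le)
  then have "emeasure lborel (box a b) \<le> emeasure lborel (half_open_box a b)"
    and "emeasure lborel (half_open_box a b) \<le> emeasure lborel (cbox a b)"
    by (auto intro!: emeasure_mono)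
  then have "emeasure lborel (half_open_box a b) = ennreal (\<Prod>i\<in>UNIV. b $ i - a $ i)"
    using le by (simp add: emeasure_lborel_box emeasure_lborel_cbox prod)
  then show ?thesis
    by simp
qed

text \<open>An intersection of preimages of intervals under linear coordinate maps. Convexity serves
  to make the cubes connected.\<close>

lemma convex_half_open_box: "convex (half_open_box a b)"
proof -
  have eq: "half_open_box a b = (\<Inter>i. {x. x $ i \<in> {a $ i..<b $ i}})"
    by (auto simp: half_open_box_def)
  have "convex {x :: real ^ 'n. x $ i \<in> {a $ i..<b $ i}}" for a b :: "real ^ 'n" and i
    using convex_linear_vimage[OF bounded_linear.linear[OF bounded_linear_vec_nth]
        convex_real_interval(7)]
    by (auto simp: vimage_def)
  then show ?thesis
    unfolding eq by (intro convex_INT)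
qed

text \<open>The Euclidean norm is at most the l1 norm. This is cruder than the diagonal, but costs
  only a factor depending on the dimension.\<close>

lemma dist_half_open_box_le:
  fixes a b :: "real ^ 'n"
  assumes "x \<in> half_open_box a b" "y \<in> half_open_box a b"
  shows "dist x y \<le> (\<Sum>i\<in>UNIV. b $ i - a $ i)"
proof -
  have "dist x y \<le> (\<Sum>i\<in>UNIV. \<bar>(x - y) $ i\<bar>)"
    unfolding dist_norm by (rule norm_le_l1_cart)
  also have "\<dots> \<le> (\<Sum>i\<in>UNIV. b $ i - a $ i)"
  proof (rule sum_mono)
    fix i
    have "a $ i \<le> x $ i" "x $ i < b $ i" "a $ i \<le> y $ i" "y $ i < b $ i"
      using assms by (auto simp: half_open_box_def)
    then show "\<bar>(x - y) $ i\<bar> \<le> b $ i - a $ i"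
      by simp
  qed
  finally show ?thesis .
qed

section \<open>Measure on the torus and neighbourhoods of the boundary\<close>

lemma emeasure_unit_cell: "emeasure lebesgue (unit_cell :: (real ^ 'n) set) = 1"
proof -
  have "unit_cell = half_open_box 0 (1 :: real ^ 'n)"
    by (auto simp: unit_cell_def half_open_box_def)
  then show ?thesis
    using emeasure_half_open_box[of 0 "1 :: real ^ 'n"] by simp
qed

lemma fmeasurable_Int_unit_cell:
  fixes A :: "'n::finite torus set"
  assumes "A \<in> sets torus_lebesgue"
  shows "torus_proj -` A \<inter> unit_cell \<in> lmeasurable"
  by (rule fmeasurableI2[of unit_cell])
    (use assms unit_cell_sets in \<open>auto simp: sets_torus_lebesgue fmeasurable_def emeasure_unit_cell\<close>)

lemma measure_torus_lebesgue:
  fixes A :: "'n::finite torus set"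
  assumes "A \<in> sets torus_lebesgue"
  shows "measure torus_lebesgue A = measure lebesgue (torus_proj -` A \<inter> unit_cell)"
  using emeasure_torus_lebesgue[OF assms] by (simp add: measure_def)

text \<open>The supremum \<open>boundary_M\<close> dominates its term at \<open>t\<close>;
  multiplying by \<open>t powr \<alpha>\<close> gives the bound.\<close>

lemma measure_boundary_nbhd_le:
  fixes \<Omega> :: "'n::finite torus set"
  assumes "boundary_M \<alpha> \<Omega> < ennreal \<gamma>" and t: "t > 0"
  shows "measure torus_lebesgue {x. dist_to_set x (frontier \<Omega>) < ereal t} \<le> \<gamma> * t powr \<alpha>"
proof -
  let ?U = "{x. dist_to_set x (frontier \<Omega>) < ereal t}"
  have "emeasure torus_lebesgue ?U = emeasure lebesgue (torus_proj -` ?U \<inter> unit_cell)"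
    by (rule emeasure_torus_lebesgue[OF sets_dist_to_set_less])
  also have "\<dots> < top"
    using fmeasurable_Int_unit_cell[OF sets_dist_to_set_less] by (auto simp: fmeasurable_def)
  \<comment> \<open>Finiteness, inherited from the unit cell, is what lets \<open>measure\<close>
    represent the extended value faithfully.\<close>
  finally have U: "emeasure torus_lebesgue ?U = ennreal (measure torus_lebesgue ?U)"
    by (intro emeasure_eq_ennreal_measure) auto
  have "ennreal (t powr (-\<alpha>)) * emeasure torus_lebesgue ?U \<le> boundary_M \<alpha> \<Omega>"
    unfolding boundary_M_def using t by (intro SUP_upper) auto
  also note assms(1)
  finally have "ennreal (t powr (-\<alpha>) * measure torus_lebesgue ?U) < ennreal \<gamma>"
    by (simp add: U ennreal_mult)
  then have "t powr (-\<alpha>) * measure torus_lebesgue ?U < \<gamma>"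
    by (subst (asm) ennreal_less_iff) auto
  then show ?thesis
    using t by (simp add: powr_minus field_simps)
qed

text \<open>The image of \<open>C\<close> in the torus is connected and meets both
  \<open>\<Omega>\<close> and its complement, hence meets the frontier; projection does not increase
  distances. The hypothesis is symmetric in \<open>\<Omega>\<close> and its complement, so it serves
  both halves of the symmetric difference.\<close>

lemma connected_meets_boundary_nbhd:
  fixes \<Omega> :: "'n::finite torus set"
  assumes "connected C" and diam: "\<And>x y. x \<in> C \<Longrightarrow> y \<in> C \<Longrightarrow> dist x y < t"
    and "x \<in> C" "y \<in> C" "torus_proj x \<in> \<Omega> \<longleftrightarrow> torus_proj y \<notin> \<Omega>"
  shows "dist_to_set (torus_proj x) (frontier \<Omega>) < ereal t"
proof -
  have "connected (torus_proj ` C)"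
    by (intro connected_continuous_image continuous_on_torus_proj assms)
  then have "torus_proj ` C \<inter> frontier \<Omega> \<noteq> {}"
    using assms by (intro connected_Int_frontier) auto
  then obtain z where z: "z \<in> C" "torus_proj z \<in> frontier \<Omega>"
    by auto
  have "dist (torus_proj x) (torus_proj z) < t"
    using dist_torus_proj_le diam[OF \<open>x \<in> C\<close> z(1)] by (rule le_less_trans)
  then show ?thesis
    using z by (auto simp: dist_to_set_def INF_less_iff)
qed

section \<open>Tiling of the unit cell by cubes\<close>

definition lattice_vec :: "nat \<Rightarrow> ('n \<Rightarrow> nat) \<Rightarrow> real ^ 'n" where
  "lattice_vec N g = (1 / real N) *\<^sub>R (\<chi> j. real (g j))"

definition cube :: "nat \<Rightarrow> ('n \<Rightarrow> nat) \<Rightarrow> (real ^ 'n) set" where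
  "cube N g = half_open_box (lattice_vec N g) (lattice_vec N (\<lambda>j. g j + 1))"

text \<open>Scaling by \<open>N\<close> makes the bounds integral: \<open>g i\<close> is the floor
  of \<open>real N * x $ i\<close>.\<close>

lemma mem_cube_iff:
  assumes "N > 0"
  shows "x \<in> cube N g \<longleftrightarrow> (\<forall>i. real (g i) \<le> real N * x $ i \<and> real N * x $ i < real (g i) + 1)"
  using assms by (simp add: cube_def half_open_box_def lattice_vec_def field_simps)

lemma measure_cube:
  fixes g :: "'n::finite \<Rightarrow> nat"
  assumes "N > 0"
  shows "cube N g \<in> lmeasurable" "measure lebesgue (cube N g) = 1 / real N ^ CARD('n)"
proof -
  have e: "emeasure lebesgue (cube N g) = ennreal (1 / real N ^ CARD('n))"
    unfolding cube_def
    by (subst emeasure_half_open_box)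
      (use assms in \<open>auto simp: lattice_vec_def divide_simps power_one_over\<close>)
  then show "cube N g \<in> lmeasurable"
    unfolding fmeasurable_def by (simp add: cube_def)
  show "measure lebesgue (cube N g) = 1 / real N ^ CARD('n)"
    using e by (simp add: measure_def)
qed

text \<open>The l1 bound gives \<open>CARD('n) / N\<close>; the extra 1 in the numerator secures the
  strict inequality that the open neighbourhood requires.\<close>

lemma dist_cube_less:
  fixes x y :: "real ^ 'n"
  assumes "N > 0" "x \<in> cube N g" "y \<in> cube N g"
  shows "dist x y < (real CARD('n) + 1) / real N"
proof -
  have "dist x y \<le> real CARD('n) / real N"
    using dist_half_open_box_le[OF assms(2,3)[unfolded cube_def]] assms(1)
    by (simp add: lattice_vec_def field_simps)
  then show ?thesis
    using assms(1) by (simp add: field_simps)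
qed

lemma cube_disjoint:
  assumes "N > 0" "g \<noteq> h"
  shows "cube N g \<inter> cube N h = {}"
proof (rule ccontr)
  assume "cube N g \<inter> cube N h \<noteq> {}"
  then obtain x where x: "x \<in> cube N g" "x \<in> cube N h"
    by auto
  have "g i = h i" for i
  proof -
    \<comment> \<open>Both unit intervals contain \<open>real N * x $ i\<close>, so the integers
      differ by less than 1.\<close>
    have "real (g i) < real (h i) + 1" "real (h i) < real (g i) + 1"
      using x assms(1) by (auto simp: mem_cube_iff intro: le_less_trans)
    then show ?thesis
      by linarith
  qed
  with assms(2) show False
    by auto
qed

lemma unit_cell_eq_UN_cube:
  assumes N: "N > 0"
  shows "(unit_cell :: (real ^ 'n) set) = (\<Union>g\<in>UNIV \<rightarrow>\<^sub>E {..<N}. cube N g)"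
proof (intro equalityI subsetI)
  fix x :: "real ^ 'n" assume "x \<in> unit_cell"
  then have x: "0 \<le> real N * x $ i" "real N * x $ i < real N" for i
    using N by (auto simp: unit_cell_def)
  \<comment> \<open>The cube containing \<open>x\<close> is found by rounding down;
    \<open>nat\<close> loses nothing because the coordinates are nonnegative.\<close>
  define g where "g = (\<lambda>i. nat \<lfloor>real N * x $ i\<rfloor>)"
  have g: "real (g i) = of_int \<lfloor>real N * x $ i\<rfloor>" for i
    using x(1)[of i] by (simp add: g_def)
  have "x \<in> cube N g"
    unfolding mem_cube_iff[OF N] g by (simp add: floor_correct)
  moreover have "g i < N" for i
    using x(2)[of i] g[of i] by (metis of_int_floor_le of_nat_less_iff le_less_trans)
  ultimately show "x \<in> (\<Union>g\<in>UNIV \<rightarrow>\<^sub>E {..<N}. cube N g)"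
    by (auto simp: PiE_UNIV_domain)
next
  fix x :: "real ^ 'n" assume "x \<in> (\<Union>g\<in>UNIV \<rightarrow>\<^sub>E {..<N}. cube N g)"
  then obtain g where g: "\<And>i. g i < N" "x \<in> cube N g"
    by (auto simp: PiE_UNIV_domain)
  show "x \<in> unit_cell"
    unfolding unit_cell_def
  proof (intro CollectI allI)
    fix i
    have *: "real (g i) \<le> real N * x $ i" "real N * x $ i < real (g i) + 1"
      using g(2) N by (auto simp: mem_cube_iff)
    have "0 \<le> real N * x $ i"
      using *(1) by (rule order_trans[rotated]) simp
    moreover have "real N * x $ i < real N"
      using *(2) g(1)[of i] by linarith
    ultimately show "0 \<le> x $ i \<and> x $ i < 1"
      using N by (simp add: zero_le_mult_iff)
  qed
qed

section \<open>Lattice points as corners of the cubes\<close>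

lemma root_eq_of_nat:
  assumes "m \<ge> 1" and "root k (real m) \<in> \<int>" and "k > 0"
  obtains N where "N > 0" "root k (real m) = real N" "N ^ k = m"
proof -
  have pos: "root k (real m) > 0"
    using assms by simp
  then obtain N where N: "root k (real m) = real N"
    using assms(2) by (metis Ints_cases of_int_0_less_iff of_int_of_nat_eq zero_less_imp_eq_int)
  moreover have "real (N ^ k) = real m"
    using real_root_pow_pos2[of k "real m"] assms N by simp
  ultimately show thesis
    using that pos by (metis of_nat_0_less_iff of_nat_eq_iff)
qed

text \<open>Passing from a set of torus points to index vectors requires that distinct indices give
  distinct points.\<close>

lemma sum_torus_lattice:
  fixes f :: "'n::finite torus \<Rightarrow> real"
  assumes m: "m \<ge> 1" and N: "root CARD('n) (real m) = real N" "N ^ CARD('n) = m"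
  shows "sum f (torus_lattice m) = (\<Sum>g\<in>UNIV \<rightarrow>\<^sub>E {..<N}. f (torus_proj (lattice_vec N g)))"
proof -
  let ?G = "UNIV \<rightarrow>\<^sub>E {..<N} :: ('n \<Rightarrow> nat) set"
  let ?p = "\<lambda>g :: 'n \<Rightarrow> nat. torus_proj (lattice_vec N g)"
  have im: "torus_lattice m = ?p ` ?G"
    unfolding torus_lattice_def N lattice_vec_def by (auto simp: PiE_UNIV_domain)
  have "card (torus_lattice m :: 'n torus set) = m"
    using m N(1) by (intro card_torus_lattice) auto
  also have "m = card ?G"
    using N(2) by (simp add: card_PiE)
  \<comment> \<open>Injectivity by counting: the image has \<open>m\<close> elements, as many as
    there are indices.\<close>
  finally have "inj_on ?p ?G"
    unfolding im by (intro eq_card_imp_inj_on finite_PiE) auto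
  then show ?thesis
    by (simp add: im sum.reindex)
qed

section \<open>Comparison of volume and lattice count\<close>

lemma discrepancy_le_boundary_nbhd:
  fixes \<Omega> :: "'n::finite torus set"
  assumes m: "m \<ge> 1" and N: "N > 0" "root CARD('n) (real m) = real N" "N ^ CARD('n) = m"
    and \<Omega>: "\<Omega> \<in> sets torus_lebesgue"
  shows "\<bar>measure torus_lebesgue \<Omega> - (1 / real m) * (\<Sum>x\<in>torus_lattice m. indicator \<Omega> x)\<bar>
    \<le> measure torus_lebesgue {x. dist_to_set x (frontier \<Omega>) < ereal ((real CARD('n) + 1) / real N)}"
proof -
  define U where
    "U = {x. dist_to_set x (frontier \<Omega>) < ereal ((real CARD('n) + 1) / real N)}"
  define G where "G = (UNIV \<rightarrow>\<^sub>E {..<N} :: ('n \<Rightarrow> nat) set)"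
  define H where "H = {g \<in> G. torus_proj (lattice_vec N g) \<in> \<Omega>}"
  define A where "A = (\<Union>g\<in>H. cube N g)"
  let ?S = "torus_proj -` \<Omega> \<inter> unit_cell" and ?V = "torus_proj -` U \<inter> unit_cell"
  have finG: "finite G"
    unfolding G_def by (intro finite_PiE) auto
  then have finH: "finite H"
    unfolding H_def by simp
  have cell: "unit_cell = (\<Union>g\<in>G. cube N g)"
    unfolding G_def by (rule unit_cell_eq_UN_cube[OF N(1)])
  have corner: "lattice_vec N g \<in> cube N g" for g :: "'n \<Rightarrow> nat"
    using N(1) by (simp add: mem_cube_iff lattice_vec_def)
  have U_sets: "U \<in> sets torus_lebesgue"
    unfolding U_def by (rule sets_dist_to_set_less)
  \<comment> \<open>A point that disagrees with the corner of its cube about membership in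
    \<open>\<Omega>\<close> is close to the boundary.\<close>
  have nbhd: "torus_proj x \<in> U"
    if "x \<in> cube N g" "torus_proj x \<in> \<Omega> \<longleftrightarrow> torus_proj (lattice_vec N g) \<notin> \<Omega>" for x g
    unfolding U_def mem_Collect_eq
  proof (rule connected_meets_boundary_nbhd)
    show "connected (cube N g)"
      unfolding cube_def by (intro convex_connected convex_half_open_box)
  qed (use that corner dist_cube_less[OF N(1)] in auto)

  \<comment> \<open>Disjointness makes the volume additive, and each cube has volume
    \<open>1 / m\<close> since \<open>N ^ CARD('n) = m\<close>.\<close>
  have "measure lebesgue A = (\<Sum>g\<in>H. measure lebesgue (cube N g))"
    unfolding A_def using finH cube_disjoint[OF N(1)] measure_cube[OF N(1)]
    by (intro measure_UNION') (auto simp: pairwise_def disjnt_def)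
  also have "\<dots> = real (card H) / real m"
    using N by (simp add: measure_cube flip: of_nat_power)
  also have "real (card H) = (\<Sum>x\<in>torus_lattice m. indicator \<Omega> x)"
    unfolding sum_torus_lattice[OF m N(2,3)] G_def[symmetric] using finG
    by (simp add: H_def indicator_def sum.If_cases Int_def)
  finally have A: "measure lebesgue A = (1 / real m) * (\<Sum>x\<in>torus_lattice m. indicator \<Omega> x)"
    by simp

  have meas: "A \<in> lmeasurable" "?S \<in> lmeasurable" "?V \<in> lmeasurable"
    unfolding A_def using finH N(1) \<Omega> U_sets
    by (auto intro!: fmeasurable.finite_UN measure_cube fmeasurable_Int_unit_cell)
  \<comment> \<open>A point of \<open>?S\<close> outside \<open>A\<close> lies in a cube whose
    corner is not in \<open>\<Omega>\<close>, so \<open>nbhd\<close> applies.\<close>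
  have "?S \<subseteq> A \<union> ?V"
    using nbhd by (auto simp: A_def H_def cell)
  then have "measure lebesgue ?S \<le> measure lebesgue (A \<union> ?V)"
    using meas by (intro measure_mono_fmeasurable fmeasurable.Un) auto
  also have "\<dots> \<le> measure lebesgue A + measure lebesgue ?V"
    using meas by (intro measure_Un_le) auto
  finally have 1: "measure lebesgue ?S \<le> measure lebesgue A + measure lebesgue ?V" .
  \<comment> \<open>Conversely, a point of \<open>A\<close> outside \<open>?S\<close> lies in a cube
    whose corner is in \<open>\<Omega>\<close>.\<close>
  have "A \<subseteq> ?S \<union> ?V"
    using nbhd by (auto simp: A_def H_def cell)
  then have "measure lebesgue A \<le> measure lebesgue (?S \<union> ?V)"
    using meas by (intro measure_mono_fmeasurable fmeasurable.Un) auto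
  also have "\<dots> \<le> measure lebesgue ?S + measure lebesgue ?V"
    using meas by (intro measure_Un_le) auto
  finally have 2: "measure lebesgue A \<le> measure lebesgue ?S + measure lebesgue ?V" .
  show ?thesis
    unfolding U_def[symmetric] measure_torus_lebesgue[OF \<Omega>] measure_torus_lebesgue[OF U_sets]
      A[symmetric]
    using 1 2 by linarith
qed

section \<open>The bound in powers of \<open>m\<close>\<close>

theorem theorem2:
  fixes \<alpha> :: real
  assumes "0 \<le> \<alpha>" and "\<alpha> \<le> 1"
  shows "\<exists>c :: real. \<forall>m :: nat. \<forall>\<gamma> :: real.
           m \<ge> 1 \<and> root CARD('n) (real m) \<in> \<int> \<and> \<gamma> > 0 \<longrightarrow>
           (SUP \<Omega>\<in>{\<Omega> :: 'n::finite torus set.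
                      \<Omega> \<in> sets torus_lebesgue \<and> boundary_M \<alpha> \<Omega> < ennreal \<gamma>}.
              ereal \<bar>measure torus_lebesgue \<Omega>
                     - (1 / real m) * (\<Sum>x\<in>torus_lattice m. indicator \<Omega> x)\<bar>)
           \<le> ereal (c * \<gamma> * real m powr (- \<alpha> / real CARD('n)))"
proof (intro exI allI impI SUP_least)
  fix m :: nat and \<gamma> :: real and \<Omega> :: "'n torus set"
  assume "m \<ge> 1 \<and> root CARD('n) (real m) \<in> \<int> \<and> \<gamma> > 0"
  then have m: "m \<ge> 1" "root CARD('n) (real m) \<in> \<int>" and \<gamma>: "\<gamma> > 0"
    by auto
  assume "\<Omega> \<in> {\<Omega>. \<Omega> \<in> sets torus_lebesgue \<and> boundary_M \<alpha> \<Omega> < ennreal \<gamma>}"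
  then have \<Omega>: "\<Omega> \<in> sets torus_lebesgue" "boundary_M \<alpha> \<Omega> < ennreal \<gamma>"
    by auto
  obtain N where N: "N > 0" "root CARD('n) (real m) = real N" "N ^ CARD('n) = m"
    using root_eq_of_nat[OF m] by auto
  define d where "d = real CARD('n)"
  have d: "d \<ge> 0"
    by (simp add: d_def)
  have t: "(d + 1) / real N > 0"
    using N(1) d by simp
  have "\<bar>measure torus_lebesgue \<Omega> - (1 / real m) * (\<Sum>x\<in>torus_lattice m. indicator \<Omega> x)\<bar>
      \<le> \<gamma> * ((d + 1) / real N) powr \<alpha>"
    using discrepancy_le_boundary_nbhd[OF m(1) N \<Omega>(1)] measure_boundary_nbhd_le[OF \<Omega>(2) t]
    unfolding d_def by (rule order_trans)
  also have "\<dots> = \<gamma> * ((d + 1) powr \<alpha> * real N powr (-\<alpha>))"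
    using d by (simp add: powr_divide powr_minus_divide)
  also have "real N = real m powr (1 / d)"
    using m(1) N(2) root_powr_inverse[of "CARD('n)" "real m"] by (simp add: d_def)
  also have "(real m powr (1 / d)) powr (-\<alpha>) = real m powr (-\<alpha> / d)"
    by (simp add: powr_powr)
  \<comment> \<open>As \<open>d + 1 \<ge> 1\<close> and \<open>\<alpha> \<le> 1\<close>, the power
    is at most \<open>d + 1\<close>, which removes \<open>\<alpha>\<close> from the
    constant.\<close>
  also have "\<gamma> * ((d + 1) powr \<alpha> * real m powr (-\<alpha> / d)) \<le> \<gamma> * ((d + 1) * real m powr (-\<alpha> / d))"
    using \<gamma> d assms powr_mono[of \<alpha> 1 "d + 1"] by (intro mult_left_mono mult_right_mono) auto
  \<comment> \<open>The witness for \<open>c\<close>, left open by \<open>exI\<close>, is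
    instantiated here to \<open>CARD('n) + 1\<close>.\<close>
  finally show "ereal \<bar>measure torus_lebesgue \<Omega>
        - (1 / real m) * (\<Sum>x\<in>torus_lattice m. indicator \<Omega> x)\<bar>
      \<le> ereal ((real CARD('n) + 1) * \<gamma> * real m powr (- \<alpha> / real CARD('n)))"
    by (simp add: d_def mult_ac)
qed

end
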